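(* Let $f$ be a polynomial of degree $m\ge 2$ such that $\Omega=\Omega(f)$ is simply connected. Let $R:\mathbb{D}\to\Omega$ be a biholomorphic map with $R(0)=\infty$, normalized (by precomposing with a rotation) so that $R^{-1}\circ f\circ R(z)=z^{m}$ on $\mathbb{D}$, and let $F=R^{-1}:\Omega\to\mathbb{D}$. Fix $r_0\in(0,1)$ and $z_0\in\mathbb{C}$ with $|z_0|=r_0$; put $w_0=R(z_0)$. For $n\ge 1$ let $z_{n,k}$ $(0\le k<m^{n})$ be the $m^n$ solutions of $z^{m^n}=z_0$ in $\mathbb{D}$, and $w_{n,k}=R(z_{n,k})$ (these are the $m^n$ preimages of $w_0$ under $f^n$), and set $$S_{n}=\sum_{k=0}^{m^{n}-1}\left|(f^{n})'(w_{n,k})\right|^{2}.$$ Then there are constants $C_1,C_2<+\infty$, independent of $p$, such that for every $2\le p\le 4$, $$\int_{\Omega\cap\mathbb{C}}|F'(z)|^{p}\,dA(z)\;<\;C_{1}\sum_{n=1}^{+\infty}m^{-4n}S_{n}+C_{2}.$$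
   Context: $\Omega(f)=\{z\in\hat{\mathbb{C}}: f^{n}(z)\to\infty\}$ is the basin of attraction of infinity ($f^n$ the $n$-th iterate), $dA$ is Lebesgue area measure. The right-hand side may be $+\infty$.
   Formalization: The bound is stated only when the series of m^{-4n} S_n converges; when it diverges the right-hand side is +∞ and the strict inequality can fail (f = z²−2, p = 4: both sides are infinite), so nothing is claimed then. *)

theory Defs
  imports "HOL-Complex_Analysis.Complex_Analysis" "HOL-Computational_Algebra.Polynomial"
begin

text \<open>The finite part \<open>\<Omega>(f) \<inter> \<complex>\<close> of the basin of attraction of infinity of a polynomial f.\<close>
definition basin_inf :: "complex poly \<Rightarrow> complex set" where
  "basin_inf f = {z. filterlim (\<lambda>n. (poly f ^^ n) z) at_infinity sequentially}"

definition S_sum :: "complex poly \<Rightarrow> (complex \<Rightarrow> complex) \<Rightarrow> complex \<Rightarrow> nat \<Rightarrow> real" where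
  "S_sum f R z0 n =
     (\<Sum>z\<in>{z. z \<in> ball 0 1 \<and> z ^ (degree f ^ n) = z0}.
        (cmod (deriv (poly f ^^ n) (R z)))\<^sup>2)"

end

theory Submission
  imports Defs
begin

text \<open>Write \<open>M = m ^ n\<close>. The relation \<open>(f ^ n) (R z) = R (z ^ M)\<close> gives
  \<open>1 / |R' \<zeta>| \<le> const * |(f ^ n)' (R \<zeta>)| / M\<close> at the roots \<open>\<zeta> ^ M = z0\<close>. Every point of the
  annulus \<open>r0 \<le> |z| ^ M\<close>, \<open>|z| ^ (m M) < r0\<close> is within distance \<open>const / M\<close> of such a root, hence
  within bounded hyperbolic distance, so by distortion \<open>|R' z|\<close> is comparable to \<open>|R' \<zeta>|\<close>, and the
  image under \<open>R\<close> of the part of the annulus near \<open>\<zeta>\<close> lies in a disc of radius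
  \<open>const * |R' \<zeta>| / M\<close>. Bounding \<open>|F'| ^ 4\<close> by a constant on each of these discs
  majorizes the integral without any change of variables: one annulus contributes at most
  \<open>const * (\<Sum>\<zeta>. 1 / (M |R' \<zeta>|)\<^sup>2) \<le> const * S_n / M ^ 4\<close>. Away from the boundary of the basin,
  \<open>|F'|\<close> is bounded and is \<open>O(1 / |w|\<^sup>2)\<close> at infinity. The exponents \<open>2 \<le> p \<le> 4\<close> are handled
  uniformly by \<open>x powr p \<le> 1 + x ^ 4\<close> on the bounded part.\<close>

section \<open>Distortion of univalent functions\<close>

text \<open>If the image contained the disc of radius 3, the inverse function would map that disc
  into the disc of radius 2 with derivative 1 at the origin. Cauchy's estimate on the radius 5/2,
  which lies strictly between 2 and 3, allows at most 4/5.\<close>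

lemma univalent_omits_value:
  assumes hol: "h holomorphic_on ball 0 2" and inj: "inj_on h (ball 0 2)"
    and h0: "h 0 = 0" and h1: "deriv h 0 = 1"
  obtains w where "w \<notin> h ` ball 0 2" "norm w < 3"
proof (rule ccontr)
  assume "\<not> thesis"
  then have sub: "ball 0 3 \<subseteq> h ` ball 0 2" using that by (meson mem_ball_0 subsetI)
  obtain k where k: "k holomorphic_on (h ` ball 0 2)"
    and kd: "\<And>z. z \<in> ball 0 2 \<Longrightarrow> deriv h z * deriv k (h z) = 1"
    and kh: "\<And>z. z \<in> ball 0 2 \<Longrightarrow> k (h z) = z"
    using holomorphic_has_inverse[OF hol open_ball inj] by metis
  have "norm ((deriv ^^ 1) k 0) \<le> fact 1 * 2 / (5/2) ^ 1"
  proof (rule Cauchy_inequality)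
    have s: "cball (0::complex) (5/2) \<subseteq> ball 0 3" by auto
    show "k holomorphic_on ball 0 (5/2)"
      by (rule holomorphic_on_subset[OF k]) (use sub s ball_subset_cball in blast)
    show "continuous_on (cball 0 (5/2)) k"
      by (rule holomorphic_on_imp_continuous_on, rule holomorphic_on_subset[OF k]) (use sub s in blast)
    fix x :: complex assume "norm (0 - x) = 5/2"
    then have "x \<in> h ` ball 0 2" using sub by auto
    then show "norm (k x) \<le> 2" using kh by force
  qed auto
  moreover have "deriv k 0 = 1" using kd[of 0] h0 h1 by simp
  ultimately show False by simp
qed

text \<open>If \<open>w\<close> is an omitted value, a branch of \<open>log (1 - h / w)\<close> omits \<open>2 \<pi> \<i>\<close> and \<open>-2 \<pi> \<i>\<close>,
  because \<open>h\<close> vanishes only at the origin, where the branch is \<open>0\<close>; so Schottky's theorem applies.\<close>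
lemma univalent_normalized_bound:
  obtains B :: real where "B > 0"
    "\<And>h z. \<lbrakk>h holomorphic_on ball 0 2; inj_on h (ball 0 2); h 0 = 0; deriv h 0 = 1; norm z \<le> 1/2\<rbrakk>
       \<Longrightarrow> norm (h z) \<le> B"
proof
  \<comment> \<open>Schottky's bound for initial modulus at most 1/2 on the disc of radius 1/2.
    \<open>L\<close> is what it becomes after undoing the affine change \<open>\<phi>\<close>, since
    \<open>g z - g 0 = 2 * pi * \<i> * (2 * \<phi> z - 1)\<close>.\<close>
  define T :: real where "T = exp(pi * exp(pi * (2 + 2 * (1/2) + 12 * (1/2) / (1 - 1/2))))"
  define L :: real where "L = 2 * pi * (2 * T + 1)"
  show "3 * (1 + exp L) > 0" by (smt (verit) exp_gt_zero)
  fix h and z :: complex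
  assume hol: "h holomorphic_on ball 0 2" and inj: "inj_on h (ball 0 2)"
    and h0: "h 0 = 0" and h1: "deriv h 0 = 1" and z: "norm z \<le> 1/2"
  obtain w where w: "w \<notin> h ` ball 0 2" "norm w < 3"
    using univalent_omits_value[OF hol inj h0 h1] .
  have w0: "w \<noteq> 0" using w(1) h0 by (metis centre_in_ball image_eqI zero_less_numeral)
  have "(\<lambda>z. 1 - h z / w) holomorphic_on ball 0 2"
    using hol w0 by (intro holomorphic_intros) auto
  moreover have "1 - h z / w \<noteq> 0" if "z \<in> ball 0 2" for z
    using w(1) w0 that by (auto simp: field_simps)
  ultimately obtain g where g: "g holomorphic_on ball 0 2"
    and eg: "\<And>z. z \<in> ball 0 2 \<Longrightarrow> 1 - h z / w = exp (g z)"
    using contractible_imp_holomorphic_log[of "\<lambda>z. 1 - h z / w" "ball 0 2"]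
      convex_imp_contractible[OF convex_ball] by metis
  \<comment> \<open>This affine change sends the values \<open>g 0 - 2 * pi * \<i>\<close> and
    \<open>g 0 + 2 * pi * \<i>\<close> of \<open>g\<close> to 0 and 1, the two values Schottky's
    theorem requires to be omitted, and \<open>g 0\<close> to 1/2.\<close>
  define \<phi> where "\<phi> = (\<lambda>z. ((g z - g 0) / (2 * pi * \<i>) + 1) / 2)"
  have eg0: "exp (g 0) = 1" using eg[of 0] h0 by simp
  have cb: "cball (0::complex) 1 \<subseteq> ball 0 2" by auto
  have "norm (\<phi> z) \<le> T"
    unfolding T_def
  proof (rule Schottky[where f=\<phi> and z=z])
    show "\<phi> holomorphic_on cball 0 1"
      unfolding \<phi>_def by (intro holomorphic_intros holomorphic_on_subset[OF g cb]) auto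
    show "norm (\<phi> 0) \<le> 1/2" by (simp add: \<phi>_def)
    show "\<not> (\<phi> x = 0 \<or> \<phi> x = 1)" if x: "x \<in> cball 0 1" for x
    proof
      assume A: "\<phi> x = 0 \<or> \<phi> x = 1"
      then have gx: "g x = g 0 - 2 * pi * \<i> \<or> g x = g 0 + 2 * pi * \<i>"
        by (auto simp: \<phi>_def field_simps)
      then have "exp (g x) = 1" using eg0 by (auto simp: exp_add exp_diff)
      moreover have xb: "x \<in> ball 0 2" using x cb by blast
      ultimately have "h x = 0" using eg[of x] w0 by auto
      then have "x = 0" using inj_onD[OF inj, of x 0] xb h0 by auto
      then show False using gx by auto
    qed
  qed (use z in auto)
  then have nphi: "norm (\<phi> z) \<le> T" .
  have "g z - g 0 = 2 * pi * \<i> * (2 * \<phi> z - 1)" by (simp add: \<phi>_def field_simps)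
  then have "norm (g z - g 0) = 2 * pi * norm (2 * \<phi> z - 1)" by (simp add: norm_mult)
  also have "\<dots> \<le> 2 * pi * (2 * T + 1)"
  proof -
    have "norm (2 * \<phi> z - 1) \<le> 2 * norm (\<phi> z) + 1"
      by (metis norm_triangle_ineq4 norm_mult norm_numeral norm_one)
    then have "norm (2 * \<phi> z - 1) \<le> 2 * T + 1" using nphi by linarith
    then show ?thesis by (simp add: mult_left_mono)
  qed
  finally have L: "norm (g z - g 0) \<le> L" by (simp add: L_def)
  have "z \<in> ball 0 2" using z by auto
  then have "1 - h z / w = exp (g z - g 0)" using eg eg0 by (simp add: exp_diff)
  then have "h z = w * (1 - exp (g z - g 0))" using w0 by (simp add: field_simps)
  then have "norm (h z) = norm w * norm (1 - exp (g z - g 0))" by (simp add: norm_mult)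
  also have "\<dots> \<le> 3 * (1 + exp L)"
  proof (intro mult_mono)
    have "norm (1 - exp (g z - g 0)) \<le> 1 + norm (exp (g z - g 0))"
      by (metis norm_triangle_ineq4 norm_one)
    also have "norm (exp (g z - g 0)) \<le> exp L"
      by (rule order_trans[OF norm_exp]) (use L in simp)
    finally show "norm (1 - exp (g z - g 0)) \<le> 1 + exp L" by simp
  qed (use w in auto)
  finally show "norm (h z) \<le> 3 * (1 + exp L)" .
qed

text \<open>A non-sharp form of Bieberbach's bound on the second coefficient. Rescaling to the disc
  of radius 2 with derivative 1 at the centre, Cauchy's estimate on radius 1/2 bounds the second
  derivative by 8 B. Undoing the scaling factor d/2 gives 16 B / d.\<close>

lemma univalent_second_derivative_bound:
  obtains K :: real where "K > 0"
    "\<And>h a d. \<lbrakk>h holomorphic_on ball a d; inj_on h (ball a d); d > 0\<rbrakk>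
       \<Longrightarrow> norm (deriv (deriv h) a) \<le> K / d * norm (deriv h a)"
proof -
  obtain B :: real where B: "B > 0"
    "\<And>h z. \<lbrakk>h holomorphic_on ball 0 2; inj_on h (ball 0 2); h 0 = 0; deriv h 0 = 1; norm z \<le> 1/2\<rbrakk>
       \<Longrightarrow> norm (h z) \<le> B"
    using univalent_normalized_bound by blast
  show ?thesis
  proof
    show "16 * B > 0" using B(1) by simp
    fix h :: "complex \<Rightarrow> complex" and a :: complex and d :: real
    assume hol: "h holomorphic_on ball a d" and inj: "inj_on h (ball a d)" and d: "d > 0"
    define c where "c = deriv h a"
    have c0: "c \<noteq> 0"
      unfolding c_def using holomorphic_injective_imp_regular[OF hol open_ball inj] d by simp
    define e where "e = complex_of_real (d / 2)"
    have e0: "e \<noteq> 0" and ne: "norm e = d / 2" using d by (auto simp: e_def)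
    have inb: "a + e * z \<in> ball a d" if "z \<in> ball 0 2" for z
      using that d by (simp add: e_def dist_norm norm_mult)
    define k where "k = (\<lambda>z. (h (a + e * z) - h a) / (c * e))"
    have kd: "(k has_field_derivative deriv h (a + e * z) / c) (at z)" if "z \<in> ball 0 2" for z
    proof -
      have "(h has_field_derivative deriv h (a + e * z)) (at (a + e * z))"
        using holomorphic_derivI[OF hol open_ball inb[OF that]] .
      then have "((\<lambda>z. h (a + e * z)) has_field_derivative deriv h (a + e * z) * e) (at z)"
        by (rule DERIV_chain2) (auto intro!: derivative_eq_intros)
      then show ?thesis unfolding k_def
        using c0 e0 by (auto intro!: derivative_eq_intros)
    qed
    have kdd: "deriv k z = deriv h (a + e * z) / c" if "z \<in> ball 0 2" for z
      using kd[OF that] by (rule DERIV_imp_deriv)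
    have khol: "k holomorphic_on ball 0 2"
      using kd unfolding holomorphic_on_open[OF open_ball] by blast
    have kinj: "inj_on k (ball 0 2)"
    proof (rule inj_onI)
      fix x y assume xy: "x \<in> ball 0 2" "y \<in> ball 0 2" "k x = k y"
      then have "h (a + e * x) = h (a + e * y)" using c0 e0 by (simp add: k_def)
      then show "x = y" using inj_onD[OF inj _ inb[OF xy(1)] inb[OF xy(2)]] e0 by simp
    qed
    have k1: "deriv k 0 = 1" using kdd[of 0] c0 by (simp add: c_def)
    have kb: "norm (k z) \<le> B" if "norm z \<le> 1/2" for z
      using B(2)[OF khol kinj _ k1 that] by (simp add: k_def)
    have "norm ((deriv ^^ 2) k 0) \<le> fact 2 * B / (1/2) ^ 2"
    proof (rule Cauchy_inequality)
      show "k holomorphic_on ball 0 (1/2)" by (rule holomorphic_on_subset[OF khol]) auto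
      show "continuous_on (cball 0 (1/2)) k"
        by (rule holomorphic_on_imp_continuous_on, rule holomorphic_on_subset[OF khol]) auto
    qed (use kb in auto)
    then have k2: "norm (deriv (deriv k) 0) \<le> 8 * B"
      by (simp add: numeral_2_eq_2 power2_eq_square)
    have "(deriv h has_field_derivative deriv (deriv h) (a + e * 0)) (at (a + e * 0))"
      by (rule holomorphic_derivI[OF holomorphic_deriv[OF hol open_ball] open_ball]) (use d in auto)
    then have "((\<lambda>z. deriv h (a + e * z)) has_field_derivative deriv (deriv h) (a + e * 0) * e) (at 0)"
      by (rule DERIV_chain2) (auto intro!: derivative_eq_intros)
    then have "((\<lambda>z. deriv h (a + e * z) / c) has_field_derivative deriv (deriv h) (a + e * 0) * e / c) (at 0)"
      by (rule DERIV_cdivide)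
    then have "(deriv k has_field_derivative deriv (deriv h) (a + e * 0) * e / c) (at 0)"
      by (rule has_field_derivative_transform_within_open[where S="ball 0 2"]) (auto simp: kdd)
    then have "deriv (deriv k) 0 = deriv (deriv h) a * e / c" by (simp add: DERIV_imp_deriv)
    then have "norm (deriv (deriv h) a) * (d/2) / norm c \<le> 8 * B"
      using k2 ne by (simp add: norm_mult norm_divide)
    then show "norm (deriv (deriv h) a) \<le> 16 * B / d * norm (deriv h a)"
      using d c0 by (simp add: c_def field_simps)
  qed
qed

text \<open>The logarithmic derivative of \<open>deriv h\<close> is bounded by K/d on
  \<open>S\<close>, so a branch of log h' is K/d-Lipschitz there. Convexity supplies both the branch
  and the mean value inequality. A general convex \<open>S\<close> with margin \<open>d\<close> is
  allowed because the application compares points in an intersection of two discs.\<close>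

lemma univalent_distortion:
  obtains K :: real where "K > 0"
    "\<And>h U S d x y. \<lbrakk>h holomorphic_on U; inj_on h U; open S; convex S; d > 0;
        \<And>s. s \<in> S \<Longrightarrow> ball s d \<subseteq> U; x \<in> S; y \<in> S\<rbrakk>
       \<Longrightarrow> norm (deriv h x) \<le> exp (K / d * norm (x - y)) * norm (deriv h y)"
proof -
  obtain K :: real where K: "K > 0"
    "\<And>h a d. \<lbrakk>h holomorphic_on ball a d; inj_on h (ball a d); d > 0\<rbrakk>
       \<Longrightarrow> norm (deriv (deriv h) a) \<le> K / d * norm (deriv h a)"
    using univalent_second_derivative_bound by blast
  show ?thesis
  proof
    show "K > 0" by fact
    fix h :: "complex \<Rightarrow> complex" and U S d x y
    assume hol: "h holomorphic_on U" and inj: "inj_on h U" and S: "open S" "convex S"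
      and d: "d > (0::real)" and sub: "\<And>s. s \<in> S \<Longrightarrow> ball s d \<subseteq> U" and xy: "x \<in> S" "y \<in> S"
    have holb: "h holomorphic_on ball s d" and injb: "inj_on h (ball s d)" if "s \<in> S" for s
      using hol inj sub[OF that] holomorphic_on_subset inj_on_subset by blast+
    have SU: "S \<subseteq> U" using sub d by (meson centre_in_ball subset_iff)
    have nz: "deriv h s \<noteq> 0" if "s \<in> S" for s
      using holomorphic_injective_imp_regular[OF holb[OF that] open_ball injb[OF that]] d by simp
    have hd: "deriv h holomorphic_on S"
      using holomorphic_deriv[OF holomorphic_on_subset[OF hol SU] S(1)] .
    obtain g where g: "g holomorphic_on S" and eg: "\<And>s. s \<in> S \<Longrightarrow> deriv h s = exp (g s)"
      using contractible_imp_holomorphic_log[OF hd convex_imp_contractible[OF S(2)] nz] by blast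
    have gd: "(g has_field_derivative deriv g s) (at s)" if "s \<in> S" for s
      using holomorphic_derivI[OF g S(1) that] .
    have "norm (g x - g y) \<le> K / d * norm (x - y)"
    proof (rule field_differentiable_bound[OF S(2) _ _ xy])
      fix s assume s: "s \<in> S"
      show "(g has_field_derivative deriv g s) (at s within S)"
        using gd[OF s] has_field_derivative_at_within by blast
      have "((\<lambda>z. exp (g z)) has_field_derivative exp (g s) * deriv g s) (at s)"
        using gd[OF s] by (auto intro!: derivative_eq_intros)
      then have "(deriv h has_field_derivative exp (g s) * deriv g s) (at s)"
        by (rule has_field_derivative_transform_within_open[OF _ S(1) s]) (simp add: eg)
      then have "deriv (deriv h) s = deriv h s * deriv g s"
        using eg[OF s] DERIV_imp_deriv by metis
      then have "norm (deriv h s) * norm (deriv g s) \<le> norm (deriv h s) * (K / d)"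
        using K(2)[OF holb[OF s] injb[OF s] d] by (simp add: norm_mult mult.commute)
      then show "norm (deriv g s) \<le> K / d"
        by (rule mult_left_le_imp_le) (use nz[OF s] in simp)
    qed
    then have "norm (exp (g x - g y)) \<le> exp (K / d * norm (x - y))"
      by (meson norm_exp order_trans exp_le_cancel_iff)
    moreover have "deriv h x = exp (g x - g y) * deriv h y"
      using eg xy by (simp add: exp_diff)
    ultimately show "norm (deriv h x) \<le> exp (K / d * norm (x - y)) * norm (deriv h y)"
      by (metis norm_mult mult_right_mono norm_ge_zero)
  qed
qed

lemma deriv_inv_into:
  assumes hol: "h holomorphic_on U" and U: "open U" and inj: "inj_on h U" and z: "z \<in> U"
  shows "deriv (inv_into U h) (h z) = inverse (deriv h z)"
proof (rule DERIV_imp_deriv, rule has_field_derivative_inverse_strong[where f=h and S=U])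
  show "DERIV h z :> deriv h z" by (rule holomorphic_derivI[OF hol U z])
  show "deriv h z \<noteq> 0" by (rule holomorphic_injective_imp_regular[OF hol U inj z])
  show "continuous_on U h" by (rule holomorphic_on_imp_continuous_on[OF hol])
qed (use U z inj in auto)

section \<open>The map near the unit circle and near its pole\<close>

text \<open>The comparison is made between logarithms. The real parts of \<open>w\<close> and of a
  logarithm of any root both lie between (ln r0)/M and 0, and the imaginary parts of logarithms of
  roots are spaced by 2 pi / M.\<close>

lemma root_near_point:
  fixes z z0 :: complex and r0 :: real
  assumes r0: "0 < r0" and z0: "norm z0 = r0" and M: "M \<ge> 1"
    and z: "r0 \<le> norm z ^ M" "norm z \<le> 1"
  obtains \<zeta> where "\<zeta> ^ M = z0" "norm (\<zeta> - z) \<le> (pi - ln r0) / real M"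
proof -
  have zn: "z \<noteq> 0" using z(1) r0 M by (auto simp: power_0_left split: if_splits)
  have z0n: "z0 \<noteq> 0" using z0 r0 by auto
  define w where "w = Ln z"
  define w0 where "w0 = Ln z0"
  \<comment> \<open>Rounding selects the logarithm of a root whose imaginary part is nearest to that
    of \<open>w\<close>, at distance at most pi / M.\<close>
  define k where "k = round ((real M * Im w - Im w0) / (2 * pi))"
  define u where "u = (w0 + 2 * of_int k * pi * \<i>) / of_nat M"
  have Mp: "real M > 0" using M by simp
  have Mu: "of_nat M * u = w0 + 2 * of_int k * pi * \<i>" using M by (simp add: u_def)
  have Reu: "Re u = ln r0 / real M" using z0 z0n
    by (simp add: u_def w0_def)
  have Imu: "Im u = (Im w0 + 2 * of_int k * pi) / real M" by (simp add: u_def)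
  have r1: "r0 \<le> 1" using z by (meson norm_ge_zero order_trans power_le_one)
  have lw: "ln r0 \<le> real M * ln (norm z)"
  proof -
    have "ln r0 \<le> ln (norm z ^ M)" using z(1) r0 by (subst ln_le_cancel_iff) auto
    then show ?thesis using zn by (simp add: ln_realpow)
  qed
  have lz: "ln (norm z) \<le> 0" using z zn by simp
  have re: "\<bar>Re (u - w)\<bar> \<le> - ln r0 / real M"
  proof -
    have "real M * ln (norm z) \<le> 0" using lz Mp by (simp add: mult_nonneg_nonpos)
    then have "\<bar>ln r0 - real M * ln (norm z)\<bar> \<le> - ln r0" using lw by linarith
    then have "\<bar>ln r0 - real M * ln (norm z)\<bar> / real M \<le> - ln r0 / real M"
      using Mp by (intro divide_right_mono) auto
    moreover have "Re (u - w) = (ln r0 - real M * ln (norm z)) / real M"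
      using Mp zn by (simp add: Reu w_def diff_divide_distrib)
    ultimately show ?thesis using Mp by (simp add: abs_divide)
  qed
  have im: "\<bar>Im (u - w)\<bar> \<le> pi / real M"
  proof -
    have "\<bar>of_int k - (real M * Im w - Im w0) / (2 * pi)\<bar> \<le> 1/2"
      unfolding k_def by (rule of_int_round_abs_le)
    then have "2 * pi * \<bar>of_int k - (real M * Im w - Im w0) / (2 * pi)\<bar> \<le> 2 * pi * (1/2)"
      by (intro mult_left_mono) auto
    moreover have "2 * pi * \<bar>of_int k - (real M * Im w - Im w0) / (2 * pi)\<bar>
        = \<bar>2 * pi * (of_int k - (real M * Im w - Im w0) / (2 * pi))\<bar>"
      by (simp add: abs_mult)
    moreover have "2 * pi * (of_int k - (real M * Im w - Im w0) / (2 * pi))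
       = Im w0 + 2 * of_int k * pi - real M * Im w"
      by (simp add: field_simps)
    ultimately have "\<bar>Im w0 + 2 * of_int k * pi - real M * Im w\<bar> \<le> pi" by simp
    then have "\<bar>Im w0 + 2 * of_int k * pi - real M * Im w\<bar> / real M \<le> pi / real M"
      using Mp by (intro divide_right_mono) auto
    moreover have "Im (u - w) = (Im w0 + 2 * of_int k * pi - real M * Im w) / real M"
      using Mp by (simp add: Imu diff_divide_distrib)
    ultimately show ?thesis using Mp by (simp add: abs_divide)
  qed
  have uw: "norm (u - w) \<le> (pi - ln r0) / real M"
    using cmod_le[of "u - w"] re im by (simp add: diff_divide_distrib)
  \<comment> \<open>The exponential is 1-Lipschitz on the closed left half plane, which is convex
    and contains \<open>u\<close> and \<open>w\<close>.\<close>
  have "norm (exp u - exp w) \<le> 1 * norm (u - w)"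
  proof (rule field_differentiable_bound[where S="{z. Re z \<le> 0}"])
    show "convex {z. Re z \<le> 0}" by (rule convex_halfspace_Re_le)
    show "u \<in> {z. Re z \<le> 0}" using Reu r1 r0 Mp by (simp add: divide_nonpos_pos)
    show "w \<in> {z. Re z \<le> 0}" using lz zn by (simp add: w_def)
    fix s :: complex assume "s \<in> {z. Re z \<le> 0}"
    then show "norm (exp s) \<le> 1" by simp
    show "(exp has_field_derivative exp s) (at s within {z. Re z \<le> 0})"
      by (auto intro!: derivative_eq_intros)
  qed
  then have "norm (exp u - z) \<le> (pi - ln r0) / real M"
    using uw zn by (simp add: w_def)
  moreover have "exp u ^ M = z0"
  proof -
    have "exp u ^ M = exp (of_nat M * u)" by (simp add: exp_of_nat_mult)
    also have "\<dots> = exp w0"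
      unfolding Mu exp_eq by (intro exI[of _ k]) (simp add: mult_ac)
    finally show ?thesis using z0n by (simp add: w0_def)
  qed
  ultimately show ?thesis using that by blast
qed

text \<open>Bernoulli's inequality turns a bound on a high power into a distance of order 1/P from
  the unit circle. That distance is the room available for the distortion estimate.\<close>

lemma le_one_minus_of_power_le:
  fixes x r :: real
  assumes "0 \<le> x" "x ^ P \<le> r" "P > 0"
  shows "x \<le> 1 - (1 - r) / real P"
proof -
  have "1 + real P * (x - 1) \<le> (1 + (x - 1)) ^ P"
    by (rule Bernoulli_inequality) (use assms in simp)
  then have "1 - r \<le> real P * (1 - x)" using assms by (simp add: algebra_simps)
  then have "(1 - r) / real P \<le> 1 - x" using assms(3) by (simp add: divide_le_eq mult.commute)
  then show ?thesis by simp
qed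

text \<open>The root and the point are O(1/M) apart, and their distance from the unit circle is also
  at least of order 1/M. The exponent in the distortion estimate is the ratio of these scales, so
  the factor \<open>A\<close> does not depend on M.\<close>

lemma distortion_near_circle:
  fixes R :: "complex \<Rightarrow> complex" and z0 :: complex and r0 :: real and m :: nat
  assumes hol: "R holomorphic_on ball 0 1 - {0}" and inj: "inj_on R (ball 0 1 - {0})"
    and r0: "0 < r0" "r0 < 1" and z0: "norm z0 = r0" and m: "m \<ge> 1"
  obtains A D :: real and M0 :: nat where "A > 0" "D > 0"
    "\<And>M z. \<lbrakk>M \<ge> M0; r0 \<le> norm z ^ M; norm z ^ (m * M) < r0\<rbrakk> \<Longrightarrow>
       \<exists>\<zeta>\<in>ball 0 1. \<zeta> ^ M = z0 \<and> norm (R z - R \<zeta>) \<le> A * norm (deriv R \<zeta>) * D / real M \<and>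
          inverse (norm (deriv R z)) \<le> A * inverse (norm (deriv R \<zeta>))"
proof -
  let ?U = "ball 0 1 - {0::complex}"
  have oU: "open ?U" by auto
  obtain K :: real where K: "K > 0"
    "\<And>h U S d x y. \<lbrakk>h holomorphic_on U; inj_on h U; open S; convex S; d > 0;
        \<And>s. s \<in> S \<Longrightarrow> ball s d \<subseteq> U; x \<in> S; y \<in> S\<rbrakk>
       \<Longrightarrow> norm (deriv h x) \<le> exp (K / d * norm (x - y)) * norm (deriv h y)"
    using univalent_distortion by blast
  define D where "D = pi - ln r0"
  have D: "D > 0" using r0 by (simp add: D_def add_pos_pos pi_gt_zero ln_less_zero less_trans[of _ 0])
  \<comment> \<open>Chosen so that the Bernoulli distance (1 - r0)/(m M) equals 2 c / M. Half of it
    is kept as the margin \<open>d\<close> around \<open>S\<close>.\<close>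
  define c where "c = (1 - r0) / (2 * real m)"
  have c: "c > 0" using r0 m by (simp add: c_def)
  define A where "A = exp (K * (2 * D) / c)"
  \<comment> \<open>The threshold \<open>n0\<close> forces the roots to have modulus at least 3/4,
    and \<open>n1\<close> makes both 2 D / M and c / M at most 1/4. Together they keep all discs
    used below away from the puncture 0.\<close>
  obtain n0 where n0: "(3/4) ^ n0 < r0" using real_arch_pow_inv[of r0 "3/4"] r0 by auto
  obtain n1 :: nat where n1: "n1 \<ge> 8 * D + 4 * c" using real_arch_simple by blast
  define M0 where "M0 = max 1 (max n0 n1)"
  show ?thesis
  proof (rule that[of A D M0])
    show "A > 0" "D > 0" using D by (auto simp: A_def)
    fix M :: nat and z :: complex
    assume M: "M \<ge> M0" and z: "r0 \<le> norm z ^ M" "norm z ^ (m * M) < r0"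
    have M1: "M \<ge> 1" "M \<ge> n0" and Mn1: "real M \<ge> 8 * D + 4 * c"
      using M n1 by (auto simp: M0_def)
    have Mp: "real M > 0" using M1 by simp
    have zle: "norm z \<le> 1"
      by (rule ccontr) (use z(2) r0(2) one_le_power[of "norm z" "m * M"] in linarith)
    obtain \<zeta> where \<zeta>: "\<zeta> ^ M = z0" "norm (\<zeta> - z) \<le> D / real M"
      using root_near_point[OF r0(1) z0 M1(1) z(1) zle] unfolding D_def by blast
    have n\<zeta>: "norm \<zeta> ^ M = r0" using \<zeta>(1) z0 by (simp add: norm_power[symmetric])
    define d where "d = c / real M"
    have d: "d > 0" using c Mp by (simp add: d_def)
    have dle: "d \<le> 1/4" using Mn1 Mp D by (simp add: d_def field_simps)
    have Dle: "2 * D / real M \<le> 1/4" using Mn1 Mp c by (simp add: field_simps)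
    have dd: "(1 - r0) / real (m * M) = 2 * d" using m Mp by (simp add: d_def c_def field_simps)
    have mM: "m * M > 0" using m M1 by simp
    have z1: "norm z \<le> 1 - 2 * d"
      using le_one_minus_of_power_le[of "norm z" "m * M" r0] z(2) mM dd by simp
    \<comment> \<open>Since r0 < 1, the root satisfies the same upper bound on its power as
      \<open>z\<close>, so it has the same distance from the circle.\<close>
    have "norm \<zeta> ^ (m * M) = r0 ^ m"
      using n\<zeta> by (simp add: mult.commute[of m] power_mult)
    also have "\<dots> \<le> r0" using power_decreasing[of 1 m r0] m r0 by simp
    finally have \<zeta>1: "norm \<zeta> \<le> 1 - 2 * d"
      using le_one_minus_of_power_le[of "norm \<zeta>" "m * M" r0] mM dd by simp
    have \<zeta>3: "norm \<zeta> \<ge> 3/4"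
    proof (rule ccontr)
      assume "\<not> norm \<zeta> \<ge> 3/4"
      then have "norm \<zeta> ^ M \<le> (3/4) ^ M" by (intro power_mono) auto
      also have "\<dots> \<le> (3/4) ^ n0" by (rule power_decreasing) (use M1 in auto)
      finally show False using n0 n\<zeta> by simp
    qed
    \<comment> \<open>The first disc leaves the margin \<open>d\<close> to the unit circle, and the
      second keeps \<open>S\<close> of size O(1/M) and far from 0.\<close>
    define S where "S = ball 0 (1 - d) \<inter> ball \<zeta> (2 * D / real M)"
    have S: "open S" "convex S" by (auto simp: S_def intro: convex_Int)
    have DM: "D / real M < 2 * D / real M" using D Mp by (simp add: divide_strict_right_mono)
    have zS: "z \<in> S" "\<zeta> \<in> S" using z1 \<zeta>1 d \<zeta>(2) DM D Mp by (auto simp: S_def dist_norm)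
    have sub: "ball s d \<subseteq> ?U" if "s \<in> S" for s
    proof
      fix x assume "x \<in> ball s d"
      then have x: "norm (s - x) < d" by (simp add: dist_norm)
      have s: "norm s < 1 - d" "norm (\<zeta> - s) < 1/4" using that Dle by (auto simp: S_def dist_norm)
      have "norm x < 1" using x s norm_triangle_sub[of x s] by (simp add: norm_minus_commute)
      moreover have "norm s > 1/2" using s(2) \<zeta>3 norm_triangle_sub[of \<zeta> s] by simp
      then have "x \<noteq> 0" using x dle by auto
      ultimately show "x \<in> ?U" by simp
    qed
    have eA: "exp (K / d * norm (x - y)) \<le> A" if "norm (x - y) \<le> 2 * D / real M" for x y :: complex
    proof -
      have "K / d * norm (x - y) \<le> K / d * (2 * D / real M)"
        using that K(1) d by (intro mult_left_mono) auto
      also have "\<dots> = K * (2 * D) / c" using Mp c by (simp add: d_def field_simps)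
      finally show ?thesis by (simp add: A_def)
    qed
    have SU: "S \<subseteq> ?U" using sub d by (meson centre_in_ball subset_iff)
    have up: "norm (deriv R s) \<le> A * norm (deriv R \<zeta>)" if s: "s \<in> S" for s
    proof -
      have "norm (s - \<zeta>) \<le> 2 * D / real M" using s by (simp add: S_def dist_norm norm_minus_commute)
      then have "exp (K / d * norm (s - \<zeta>)) * norm (deriv R \<zeta>) \<le> A * norm (deriv R \<zeta>)"
        using eA by (intro mult_right_mono) auto
      with K(2)[OF hol inj S d sub s zS(2)] show ?thesis by linarith
    qed
    have "norm (R z - R \<zeta>) \<le> A * norm (deriv R \<zeta>) * norm (z - \<zeta>)"
    proof (rule field_differentiable_bound[OF S(2) _ up zS])
      fix s assume "s \<in> S"
      then show "(R has_field_derivative deriv R s) (at s within S)"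
        using holomorphic_derivI[OF hol oU] SU has_field_derivative_at_within by blast
    qed
    also have "\<dots> \<le> A * norm (deriv R \<zeta>) * (D / real M)"
      using \<zeta>(2) by (intro mult_left_mono) (auto simp: norm_minus_commute A_def)
    finally have 1: "norm (R z - R \<zeta>) \<le> A * norm (deriv R \<zeta>) * D / real M" by simp
    have nz: "deriv R s \<noteq> 0" if "s \<in> S" for s
      using holomorphic_injective_imp_regular[OF hol oU inj] SU that by blast
    have "norm (\<zeta> - z) \<le> 2 * D / real M" using \<zeta>(2) DM by simp
    then have "exp (K / d * norm (\<zeta> - z)) * norm (deriv R z) \<le> A * norm (deriv R z)"
      using eA by (intro mult_right_mono) auto
    then have "norm (deriv R \<zeta>) \<le> A * norm (deriv R z)"
      using K(2)[OF hol inj S d sub zS(2) zS(1)] by linarith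
    then have 2: "inverse (norm (deriv R z)) \<le> A * inverse (norm (deriv R \<zeta>))"
      using nz[OF zS(1)] nz[OF zS(2)] by (simp add: field_simps)
    have "\<zeta> \<in> ball 0 1" using \<zeta>1 d by simp
    then show "\<exists>\<zeta>\<in>ball 0 1. \<zeta> ^ M = z0 \<and> norm (R z - R \<zeta>) \<le> A * norm (deriv R \<zeta>) * D / real M \<and>
          inverse (norm (deriv R z)) \<le> A * inverse (norm (deriv R \<zeta>))"
      using 1 2 \<zeta>(1) by blast
  qed
qed

text \<open>The reciprocal of \<open>R\<close> extends to an injective holomorphic function
  \<open>Q\<close> across 0, so \<open>deriv Q\<close> has no zero there. Differentiating R = 1/Q
  gives |R'| = |R|^2 |Q'|, which is the source of the decay 1/|w|^2 of the derivative of the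
  inverse.\<close>

lemma univalent_pole_bounds:
  fixes R :: "complex \<Rightarrow> complex"
  assumes hol: "R holomorphic_on ball 0 1 - {0}" and inj: "inj_on R (ball 0 1 - {0})"
    and pole: "filterlim R at_infinity (at 0)"
  obtains \<epsilon> B C :: real where "0 < \<epsilon>" "\<epsilon> < 1" "B > 0" "C > 0"
    "\<And>z. \<lbrakk>z \<noteq> 0; norm z < \<epsilon>\<rbrakk> \<Longrightarrow> norm (R z) \<ge> 1 \<and> inverse (norm (deriv R z)) \<le> C / norm (R z) ^ 2"
    "\<And>z. \<lbrakk>z \<in> ball 0 1; norm z \<ge> \<epsilon>\<rbrakk> \<Longrightarrow> norm (R z) \<le> B"
proof -
  have "eventually (\<lambda>z. norm (R z) \<ge> 1) (at 0)"
    using pole unfolding filterlim_at_infinity[OF order_refl] by (meson zero_less_one)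
  then obtain e where e: "e > 0" and Re: "\<And>z. \<lbrakk>z \<noteq> 0; norm z < e\<rbrakk> \<Longrightarrow> norm (R z) \<ge> 1"
    unfolding eventually_at by (auto simp: dist_norm)
  define e0 where "e0 = min e 1"
  have e0: "e0 > 0" "e0 \<le> 1" "e0 \<le> e" using e by (auto simp: e0_def)
  have Rn: "norm (R z) \<ge> 1" if "z \<in> ball 0 e0 - {0}" for z using Re that e0 by auto
  have Rn0: "R z \<noteq> 0" if "z \<in> ball 0 e0 - {0}" for z using Rn[OF that] by auto
  have sub: "ball 0 e0 - {0} \<subseteq> ball 0 1 - {0::complex}" using e0 by auto
  define Q where "Q = (\<lambda>z. if z = 0 then 0 else inverse (R z))"
  have Qhol: "Q holomorphic_on ball 0 e0"
    unfolding Q_def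
  proof (rule removable_singularity)
    show "(\<lambda>y. inverse (R y)) holomorphic_on ball 0 e0 - {0}"
      using Rn0 by (intro holomorphic_intros holomorphic_on_subset[OF hol sub]) auto
    show "((\<lambda>y. inverse (R y)) \<longlongrightarrow> 0) (at 0)"
      using filterlim_compose[OF tendsto_inverse_0 pole] .
  qed auto
  have Qinj: "inj_on Q (ball 0 e0)"
  proof (rule inj_onI)
    fix x y assume xy: "x \<in> ball 0 e0" "y \<in> ball 0 e0" "Q x = Q y"
    show "x = y"
    proof (cases "x = 0 \<or> y = 0")
      case True
      then show ?thesis using xy Rn0 by (auto simp: Q_def split: if_splits)
    next
      case False
      then have "R x = R y" using xy by (simp add: Q_def)
      then show ?thesis using inj_onD[OF inj, of x y] False xy e0 by auto
    qed
  qed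
  have Qd: "deriv Q z \<noteq> 0" if "z \<in> ball 0 e0" for z
    using holomorphic_injective_imp_regular[OF Qhol open_ball Qinj that] .
  \<comment> \<open>Halving the radius leaves a compact disc on which 1/Q' is bounded.\<close>
  define \<epsilon> where "\<epsilon> = e0 / 2"
  have \<epsilon>: "0 < \<epsilon>" "\<epsilon> < 1" "\<epsilon> < e0" using e0 by (auto simp: \<epsilon>_def)
  have cb: "cball 0 \<epsilon> \<subseteq> ball (0::complex) e0" using \<epsilon> by auto
  have "continuous_on (cball 0 \<epsilon>) (\<lambda>z. inverse (deriv Q z))"
    using Qd cb holomorphic_deriv[OF Qhol open_ball]
    by (intro continuous_on_inverse continuous_on_subset[OF holomorphic_on_imp_continuous_on cb]) auto
  then have "bounded ((\<lambda>z. inverse (deriv Q z)) ` cball 0 \<epsilon>)"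
    by (intro compact_imp_bounded compact_continuous_image) auto
  then obtain C where C: "C > 0" "\<And>z. z \<in> cball 0 \<epsilon> \<Longrightarrow> norm (inverse (deriv Q z)) \<le> C"
    unfolding bounded_pos by auto
  \<comment> \<open>A neighbourhood of 0 is covered by \<open>Q\<close> on the small disc. By
    injectivity, values of \<open>R\<close> of modulus above 1/\<eta> are taken only there, which
    bounds \<open>R\<close> on the rest of the unit disc.\<close>
  have "open (Q ` ball 0 \<epsilon>)"
    using open_mapping_thm3[of Q "ball 0 \<epsilon>"] holomorphic_on_subset[OF Qhol] inj_on_subset[OF Qinj] cb
    by (meson ball_subset_cball open_ball subset_trans)
  moreover have "0 \<in> Q ` ball 0 \<epsilon>" using \<epsilon> by (auto simp: Q_def image_iff intro!: bexI[of _ 0])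
  ultimately obtain \<eta> where \<eta>: "\<eta> > 0" "ball 0 \<eta> \<subseteq> Q ` ball 0 \<epsilon>" by (meson openE)
  show ?thesis
  proof (rule that[of \<epsilon> "1 / \<eta>" C])
    fix z :: complex assume z: "z \<noteq> 0" "norm z < \<epsilon>"
    then have zb: "z \<in> ball 0 e0 - {0}" using \<epsilon> by auto
    have "(Q has_field_derivative deriv Q z) (at z)"
      by (rule holomorphic_derivI[OF Qhol open_ball]) (use zb in auto)
    then have "((\<lambda>z. inverse (Q z)) has_field_derivative - (inverse (Q z) * deriv Q z * inverse (Q z))) (at z)"
      using Rn0[OF zb] z by (intro DERIV_inverse') (auto simp: Q_def)
    then have "(R has_field_derivative - (inverse (Q z) * deriv Q z * inverse (Q z))) (at z)"
      by (rule has_field_derivative_transform_within_open[where S="ball 0 e0 - {0}"])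
         (use zb in \<open>auto simp: Q_def\<close>)
    then have "deriv R z = - (R z * deriv Q z * R z)"
      using z by (simp add: DERIV_imp_deriv Q_def)
    then have "norm (deriv R z) = norm (R z) ^ 2 * norm (deriv Q z)"
      by (simp add: norm_mult power2_eq_square)
    then have "inverse (norm (deriv R z)) = norm (inverse (deriv Q z)) / norm (R z) ^ 2"
      by (simp add: norm_inverse divide_inverse)
    also have "\<dots> \<le> C / norm (R z) ^ 2" using C(2)[of z] z by (intro divide_right_mono) auto
    finally show "norm (R z) \<ge> 1 \<and> inverse (norm (deriv R z)) \<le> C / norm (R z) ^ 2"
      using Rn[OF zb] by simp
  next
    fix z :: complex assume z: "z \<in> ball 0 1" "norm z \<ge> \<epsilon>"
    show "norm (R z) \<le> 1 / \<eta>"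
    proof (rule ccontr)
      assume "\<not> norm (R z) \<le> 1 / \<eta>"
      then have big: "norm (R z) > 1 / \<eta>" by simp
      then have "norm (R z) > 0" using \<eta>(1) by (smt (verit) divide_pos_pos)
      then have "inverse (R z) \<in> ball 0 \<eta>" using big \<eta>(1)
        by (simp add: norm_divide field_simps)
      then obtain y where y: "y \<in> ball 0 \<epsilon>" "inverse (R z) = Q y" using \<eta> by blast
      have "y \<noteq> 0" using y(2) \<open>norm (R z) > 0\<close> by (auto simp: Q_def)
      then have "R z = R y" using y(2) by (simp add: Q_def)
      then have "z = y" using inj_onD[OF inj, of z y] z y \<open>y \<noteq> 0\<close> \<epsilon> by force
      then show False using y z by auto
    qed
  qed (use \<epsilon> C \<eta> in auto)
qed

section \<open>Iterates of the polynomial\<close>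

lemma poly_basin_inf:
  assumes "w \<in> basin_inf f"
  shows "poly f w \<in> basin_inf f"
proof -
  have "filterlim (\<lambda>n. (poly f ^^ Suc n) w) at_infinity sequentially"
    using assms by (subst filterlim_sequentially_Suc) (simp add: basin_inf_def)
  then show ?thesis by (simp add: basin_inf_def funpow_swap1)
qed

text \<open>The conjugacy is given through \<open>inv_into\<close>, which can be undone only on the
  image of \<open>R\<close>. Forward invariance of the basin guarantees that
  \<open>poly f (R z)\<close> lies there.\<close>

lemma semiconj_iterate:
  assumes onto: "R ` (ball 0 1 - {0}) = basin_inf f"
    and conj: "\<And>z. z \<in> ball 0 1 - {0} \<Longrightarrow> inv_into (ball 0 1 - {0}) R (poly f (R z)) = z ^ m"
    and m: "m \<ge> 1" and z: "z \<in> ball 0 1 - {0::complex}"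
  shows "(poly f ^^ n) (R z) = R (z ^ m ^ n)"
proof (induction n)
  case (Suc n)
  let ?U = "ball 0 1 - {0::complex}"
  have y: "z ^ m ^ n \<in> ?U"
    using z m by (auto simp: norm_power power_less_one_iff)
  have "poly f (R (z ^ m ^ n)) \<in> R ` ?U"
    using poly_basin_inf onto y by blast
  then have "R ((z ^ m ^ n) ^ m) = poly f (R (z ^ m ^ n))"
    using conj[OF y] f_inv_into_f by metis
  then show ?case using Suc by (simp add: power_mult[symmetric] mult.commute)
qed auto

lemma funpow_poly_differentiable: "(poly f ^^ n) field_differentiable (at (x::complex))"
proof (induction n arbitrary: x)
  case 0
  show ?case by (simp add: id_def)
next
  case (Suc n)
  have "poly f field_differentiable (at ((poly f ^^ n) x))"
    using poly_DERIV field_differentiable_def by blast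
  then show ?case using field_differentiable_compose[OF Suc] by (simp add: comp_def)
qed

lemma deriv_semiconj_iterate:
  assumes hol: "R holomorphic_on ball 0 1 - {0}"
    and onto: "R ` (ball 0 1 - {0}) = basin_inf f"
    and conj: "\<And>z. z \<in> ball 0 1 - {0} \<Longrightarrow> inv_into (ball 0 1 - {0}) R (poly f (R z)) = z ^ m"
    and m: "m \<ge> 1" and z: "z \<in> ball 0 1 - {0::complex}"
  shows "deriv (poly f ^^ n) (R z) * deriv R z = deriv R (z ^ m ^ n) * (of_nat (m ^ n) * z ^ (m ^ n - 1))"
proof -
  let ?U = "ball 0 1 - {0::complex}"
  have oU: "open ?U" by auto
  have y: "z ^ m ^ n \<in> ?U"
    using z m by (auto simp: norm_power power_less_one_iff)
  have "((poly f ^^ n) has_field_derivative deriv (poly f ^^ n) (R z)) (at (R z))"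
    using funpow_poly_differentiable field_differentiable_derivI by blast
  then have 1: "((\<lambda>x. (poly f ^^ n) (R x)) has_field_derivative deriv (poly f ^^ n) (R z) * deriv R z) (at z)"
    by (rule DERIV_chain2) (rule holomorphic_derivI[OF hol oU z])
  have p: "((\<lambda>x. x ^ m ^ n) has_field_derivative (of_nat (m ^ n) * z ^ (m ^ n - 1))) (at z)"
    by (auto intro!: derivative_eq_intros)
  have "((\<lambda>x. R (x ^ m ^ n)) has_field_derivative deriv R (z ^ m ^ n) * (of_nat (m ^ n) * z ^ (m ^ n - 1))) (at z)"
    by (rule DERIV_chain2[OF holomorphic_derivI[OF hol oU y] p])
  then have "((\<lambda>x. (poly f ^^ n) (R x)) has_field_derivative
      deriv R (z ^ m ^ n) * (of_nat (m ^ n) * z ^ (m ^ n - 1))) (at z)"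
    by (rule has_field_derivative_transform_within_open[OF _ oU z])
       (rule semiconj_iterate[OF onto conj m, symmetric])
  then show ?thesis using 1 DERIV_unique by blast
qed

text \<open>This is how the summands of \<open>S_sum\<close> enter. In the differentiated conjugacy
  at a root, the factor R'(z0) is independent of n and of the root, and with M = m^n one has
  |z|^(M-1) \<ge> |z|^M = |z0|, so the derivative of the power is at least |z0| M in
  modulus.\<close>

lemma inverse_deriv_at_root_bound:
  assumes hol: "R holomorphic_on ball 0 1 - {0}" and inj: "inj_on R (ball 0 1 - {0})"
    and onto: "R ` (ball 0 1 - {0}) = basin_inf f"
    and conj: "\<And>z. z \<in> ball 0 1 - {0} \<Longrightarrow> inv_into (ball 0 1 - {0}) R (poly f (R z)) = z ^ m"
    and m: "m \<ge> 1" and z: "z \<in> ball 0 1" and zz: "z ^ m ^ n = z0" and z0: "z0 \<in> ball 0 1 - {0}"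
  shows "inverse (norm (deriv R z)) \<le>
    norm (deriv (poly f ^^ n) (R z)) / (norm (deriv R z0) * norm z0 * real m ^ n)"
proof -
  have zn: "z \<in> ball 0 1 - {0}" using z zz z0 m by (auto simp: power_0_left split: if_splits)
  have nz: "deriv R x \<noteq> 0" if "x \<in> ball 0 1 - {0}" for x
    using holomorphic_injective_imp_regular[OF hol _ inj that] by auto
  have "norm z0 = norm z ^ m ^ n" using zz by (simp add: norm_power[symmetric])
  also have "\<dots> \<le> norm z ^ (m ^ n - 1)" using zn by (intro power_decreasing) auto
  finally have le: "norm z0 \<le> norm z ^ (m ^ n - 1)" .
  have "norm (deriv R z0) * norm z0 * real m ^ n \<le> norm (deriv R z0) * norm z ^ (m ^ n - 1) * real m ^ n"
    using le by (intro mult_right_mono mult_left_mono) auto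
  also have "\<dots> = norm (deriv (poly f ^^ n) (R z) * deriv R z)"
    using deriv_semiconj_iterate[OF hol onto conj m zn, of n] zz by (simp add: norm_mult norm_power)
  finally show ?thesis using nz[OF zn] nz[OF z0] z0 m by (simp add: norm_mult field_simps)
qed

section \<open>The integrable majorant\<close>

lemma emeasure_cball_complex:
  fixes c :: complex
  assumes "r \<ge> 0"
  shows "emeasure lborel (cball c r) = ennreal (pi * r\<^sup>2)"
  using emeasure_cball[OF assms, of c] by (simp add: unit_ball_vol_2)

lemma powr_le_max_one_power4:
  fixes x c p :: real
  assumes "0 \<le> x" "x \<le> c" "1 \<le> c" "2 \<le> p" "p \<le> 4"
  shows "x powr p \<le> c ^ 4"
proof -
  have "x powr p \<le> c powr p" using assms by (intro powr_mono2) auto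
  also have "\<dots> \<le> c powr 4" using assms by (intro powr_mono) auto
  also have "\<dots> = c ^ 4" using assms by (simp add: powr_realpow[of c 4, simplified])
  finally show ?thesis .
qed

lemma powr_le_one_plus_power4:
  fixes x p :: real
  assumes "0 \<le> x" "2 \<le> p" "p \<le> 4"
  shows "x powr p \<le> 1 + x ^ 4"
proof (cases "x \<le> 1")
  case True
  then show ?thesis using powr_le_max_one_power4[of x 1 p] assms by (simp add: add_increasing2)
next
  case False
  then show ?thesis using powr_le_max_one_power4[of x x p] assms by simp
qed

text \<open>Used near infinity, with s the modulus of the point: p \<ge> 2 makes (s^2)^p at least
  s^4, so the decay is integrable over the plane uniformly in p.\<close>

lemma powr_le_power4_div:
  fixes x c s p :: real
  assumes "0 \<le> x" "1 \<le> c" "1 \<le> s" "x \<le> c / s ^ 2" "2 \<le> p" "p \<le> 4"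
  shows "x powr p \<le> c ^ 4 / s ^ 4"
proof -
  have "x powr p \<le> (c / s ^ 2) powr p" using assms by (intro powr_mono2) auto
  also have "\<dots> = c powr p / (s ^ 2) powr p" using assms by (simp add: powr_divide)
  also have "\<dots> \<le> c ^ 4 / s ^ 4"
  proof (rule frac_le)
    show "c powr p \<le> c ^ 4" using powr_le_max_one_power4[of c c p] assms by simp
    have "s ^ 4 = (s ^ 2) powr 2" using assms by (simp add: powr_numeral power_mult[symmetric])
    also have "\<dots> \<le> (s ^ 2) powr p" using assms by (intro powr_mono) auto
    finally show "s ^ 4 \<le> (s ^ 2) powr p" .
  qed (use assms in auto)
  finally show ?thesis .
qed

lemma ennreal_term_le_suminf: "f k \<le> suminf f" for f :: "nat \<Rightarrow> ennreal"
  using sum_le_suminf[OF summableI, of "{k}" f] by simp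

text \<open>A substitute for 1/|w|^4 outside the unit disc. Being a combination of indicators of
  discs, it is integrated by disc areas alone, without polar coordinates.\<close>

definition dyadic_majorant :: "complex \<Rightarrow> ennreal" where
  "dyadic_majorant w = (\<Sum>k. ennreal (1 / 16 ^ k) * indicator (cball 0 (2 ^ Suc k)) w)"

lemma dyadic_majorant_measurable [measurable]: "dyadic_majorant \<in> borel_measurable lborel"
  unfolding dyadic_majorant_def
  by (intro borel_measurable_suminf_order borel_measurable_times_ennreal borel_measurable_const
      borel_measurable_indicator) simp

lemma dyadic_majorant_ge:
  assumes "norm w \<ge> 1"
  shows "ennreal (1 / norm w ^ 4) \<le> dyadic_majorant w"
proof -
  obtain n where n: "norm w < 2 ^ n" using real_arch_pow[of 2 "norm w"] by auto
  \<comment> \<open>The dyadic index with 2^k \<le> |w| < 2^(k+1). Minimality gives the lower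
    inequality, except for k = 0, where it is the assumption.\<close>
  define k where "k = (LEAST n. norm w < 2 ^ Suc n)"
  have ex: "norm w < 2 ^ Suc n" using n by (rule less_le_trans) simp
  have k: "norm w < 2 ^ Suc k" unfolding k_def by (rule LeastI[of _ n]) (rule ex)
  have "2 ^ k \<le> norm w"
  proof (cases k)
    case (Suc j)
    then have "\<not> norm w < 2 ^ Suc j" unfolding k_def using not_less_Least by (metis lessI)
    then show ?thesis using Suc by simp
  qed (use assms in simp)
  then have "(2 ^ k) ^ 4 \<le> norm w ^ 4" by (intro power_mono) auto
  moreover have "((2::real) ^ k) ^ 4 = 16 ^ k"
    by (simp add: power_mult[symmetric] mult.commute[of k] power_mult)
  ultimately have "1 / norm w ^ 4 \<le> 1 / 16 ^ k" by (intro frac_le) auto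
  then have "ennreal (1 / norm w ^ 4) \<le> ennreal (1 / 16 ^ k) * indicator (cball 0 (2 ^ Suc k)) w"
    using k by (simp add: ennreal_leI)
  also have "\<dots> \<le> dyadic_majorant w" unfolding dyadic_majorant_def
    by (rule ennreal_term_le_suminf)
  finally show ?thesis .
qed

text \<open>The area 4 pi 4^k of the k-th disc against the weight 16^(-k) leaves a geometric series
  of ratio 1/4.\<close>

lemma dyadic_majorant_integral:
  "(\<integral>\<^sup>+ w. dyadic_majorant w \<partial>lborel) = ennreal (16 * pi / 3)"
proof -
  have "(\<integral>\<^sup>+ w. dyadic_majorant w \<partial>lborel) =
      (\<Sum>k. \<integral>\<^sup>+ w. ennreal (1 / 16 ^ k) * indicator (cball 0 (2 ^ Suc k)) (w::complex) \<partial>lborel)"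
    unfolding dyadic_majorant_def 
    by (intro nn_integral_suminf borel_measurable_times_ennreal borel_measurable_const
        borel_measurable_indicator) simp
  also have "\<dots> = (\<Sum>k. ennreal (4 * pi * (1/4) ^ k))"
  proof (rule arg_cong[of _ _ suminf], rule ext)
    fix k :: nat
    have p: "((2::real) ^ k)\<^sup>2 = 4 ^ k" by (simp add: power_mult[symmetric] mult.commute[of k] power_mult)
    have q: "(16::real) ^ k = 4 ^ k * 4 ^ k" by (simp add: power_mult_distrib[symmetric])
    have "(\<integral>\<^sup>+ w. ennreal (1 / 16 ^ k) * indicator (cball 0 (2 ^ Suc k)) (w::complex) \<partial>lborel)
        = ennreal (1 / 16 ^ k) * ennreal (pi * (2 ^ Suc k)\<^sup>2)"
      by (simp add: nn_integral_cmult_indicator emeasure_cball_complex del: power_Suc)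
    also have "\<dots> = ennreal (1 / 16 ^ k * (pi * (2 ^ Suc k)\<^sup>2))" by (rule ennreal_mult[symmetric]) auto
    also have "1 / 16 ^ k * (pi * (2 ^ Suc k)\<^sup>2) = 4 * pi * (1/4) ^ k"
      by (simp add: p q power_mult_distrib power_divide)
    finally show "(\<integral>\<^sup>+ w. ennreal (1 / 16 ^ k) * indicator (cball 0 (2 ^ Suc k)) (w::complex) \<partial>lborel)
        = ennreal (4 * pi * (1/4) ^ k)" .
  qed
  also have "\<dots> = ennreal (16 * pi / 3)"
  proof (rule suminf_ennreal_eq)
    show "(\<lambda>k. 4 * pi * (1/4) ^ k) sums (16 * pi / 3)"
      using sums_mult[OF geometric_sums[of "1/4::real"], of "4 * pi"] by simp
  qed simp
  finally show ?thesis .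
qed

text \<open>The numbers x^(m^n) decrease to 0 as n grows, so there is a last n at which they are
  still at least r0. The hypothesis at N forces this n to be at least N. Hence the annuli of index
  at least N cover everything close to the circle.\<close>

lemma exists_annulus_index:
  fixes x r0 :: real
  assumes "0 \<le> x" "x < 1" "0 < r0" "2 \<le> m" "r0 \<le> x ^ m ^ N"
  obtains n where "n \<ge> N" "r0 \<le> x ^ m ^ n" "x ^ (m * m ^ n) < r0"
proof -
  obtain j where j: "x ^ j < r0" using real_arch_pow_inv[of r0 x] assms by auto
  have "j \<le> m ^ j" using power_gt_expt[of m j] assms by simp
  then have "x ^ m ^ j \<le> x ^ j" using assms by (intro power_decreasing) auto
  then have ex: "x ^ m ^ j < r0" using j by linarith
  define k where "k = (LEAST n. x ^ m ^ n < r0)"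
  have k: "x ^ m ^ k < r0" unfolding k_def by (rule LeastI, rule ex)
  have "k > N"
  proof (rule ccontr)
    assume "\<not> k > N"
    then have "x ^ m ^ N \<le> x ^ m ^ k" using assms by (intro power_decreasing power_increasing) auto
    then show False using k assms by linarith
  qed
  then obtain n where n: "k = Suc n" "n \<ge> N" by (metis Suc_le_D less_Suc_eq_le Suc_leI)
  have "\<not> x ^ m ^ n < r0" using not_less_Least[of n] n(1) unfolding k_def by (metis lessI)
  then show ?thesis using that[of n] n k by simp
qed

text \<open>The terms of the series are nonnegative, so without summability its sum is +\<infinity>.
  Assuming \<open>summable\<close> makes the real-valued infinite sum the true one. The shift
  \<open>Suc n\<close> starts the series at index 1.\<close>

theorem mainTheorem5:
  fixes f :: "complex poly" and m :: nat
    and R F :: "complex \<Rightarrow> complex" and r0 :: real and z0 :: complex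
  assumes deg: "degree f = m" and m2: "m \<ge> 2"
    and R_holo: "R holomorphic_on (ball 0 1 - {0})"
    and R_inj: "inj_on R (ball 0 1 - {0})"
    and R_onto: "R ` (ball 0 1 - {0}) = basin_inf f"
    and R_pole: "filterlim R at_infinity (at 0)"
    and F_def: "F = inv_into (ball 0 1 - {0}) R"
    and conj: "\<And>z. z \<in> ball 0 1 - {0} \<Longrightarrow> F (poly f (R z)) = z ^ m"
    and r0: "0 < r0" "r0 < 1" and z0: "cmod z0 = r0"
  shows "\<exists>C1 C2 :: real. \<forall>p::real. 2 \<le> p \<and> p \<le> 4 \<longrightarrow>
           (summable (\<lambda>n. real m powr (- 4 * real (Suc n)) * S_sum f R z0 (Suc n)) \<longrightarrow>
            (\<integral>\<^sup>+ z \<in> basin_inf f. ennreal (cmod (deriv F z) powr p) \<partial>lborel)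
              < ennreal (C1 * (\<Sum>n. real m powr (- 4 * real (Suc n)) * S_sum f R z0 (Suc n)) + C2))"

proof -

  \<comment> \<open>Constants for the pole, the compact middle region and the annuli\<close>
  let ?U = "ball 0 1 - {0::complex}"
  have oU: "open ?U" by auto
  have conj': "inv_into ?U R (poly f (R z)) = z ^ m" if "z \<in> ?U" for z
    using conj[OF that] by (simp add: F_def)
  have m1: "m \<ge> 1" using m2 by simp
  have z0U: "z0 \<in> ?U" using z0 r0 by auto
  have nz: "deriv R z \<noteq> 0" if "z \<in> ?U" for z
    by (rule holomorphic_injective_imp_regular[OF R_holo oU R_inj that])
  have dF: "norm (deriv F (R z)) = inverse (norm (deriv R z))" if "z \<in> ?U" for z
    unfolding F_def by (simp add: deriv_inv_into[OF R_holo oU R_inj that] norm_inverse)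
  obtain A D :: real and M0 :: nat where A: "A > 0" and D: "D > 0" and
    near: "\<And>M z. \<lbrakk>M \<ge> M0; r0 \<le> norm z ^ M; norm z ^ (m * M) < r0\<rbrakk> \<Longrightarrow>
       \<exists>\<zeta>\<in>ball 0 1. \<zeta> ^ M = z0 \<and> norm (R z - R \<zeta>) \<le> A * norm (deriv R \<zeta>) * D / real M \<and>
          inverse (norm (deriv R z)) \<le> A * inverse (norm (deriv R \<zeta>))"
    using distortion_near_circle[OF R_holo R_inj r0 z0 m1] by blast
  obtain \<epsilon> B C :: real where \<epsilon>: "0 < \<epsilon>" "\<epsilon> < 1" and B: "B > 0" and C: "C > 0" and
    pole: "\<And>z. \<lbrakk>z \<noteq> 0; norm z < \<epsilon>\<rbrakk> \<Longrightarrow> norm (R z) \<ge> 1 \<and> inverse (norm (deriv R z)) \<le> C / norm (R z) ^ 2" and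
    bdd: "\<And>z. \<lbrakk>z \<in> ball 0 1; norm z \<ge> \<epsilon>\<rbrakk> \<Longrightarrow> norm (R z) \<le> B"
    using univalent_pole_bounds[OF R_holo R_inj R_pole] by blast
  \<comment> \<open>At least 1, so that every annulus index used is a successor and occurs in the
    series; at least \<open>M0\<close>, so that m^n > n reaches the threshold of the distortion
    estimate.\<close>
  define N where "N = max 1 M0"
  have MN: "m ^ n \<ge> M0" if "n \<ge> N" for n
    using power_gt_expt[of m n] that m2 by (simp add: N_def)
  \<comment> \<open>The region between the disc around the pole and the annuli. It is compact in the
    punctured disc, so 1/|R'| is bounded on it.\<close>
  define T where "T = {z::complex. \<epsilon> \<le> norm z \<and> norm z ^ m ^ N \<le> r0}"
  have TU: "T \<subseteq> ?U"
  proof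
    fix z assume z: "z \<in> T"
    then have "norm z ^ m ^ N < 1" using r0 by (simp add: T_def)
    then have "norm z < 1" by (meson linorder_not_le one_le_power)
    then show "z \<in> ?U" using z \<epsilon> by (auto simp: T_def)
  qed
  have "closed T" unfolding T_def
    by (intro closed_Collect_conj closed_Collect_le continuous_intros)
  moreover have "bounded T" using TU by (meson bounded_ball bounded_diff bounded_subset)
  ultimately have "compact T" by (simp add: compact_eq_bounded_closed)
  moreover have "continuous_on T (\<lambda>z. inverse (deriv R z))"
  proof (rule continuous_on_inverse)
    show "continuous_on T (deriv R)"
      by (rule continuous_on_subset[OF holomorphic_on_imp_continuous_on TU])
        (rule holomorphic_deriv[OF R_holo oU])
    show "\<forall>z\<in>T. deriv R z \<noteq> 0" using nz TU by blast
  qed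
  ultimately have "bounded ((\<lambda>z. inverse (deriv R z)) ` T)"
    by (intro compact_imp_bounded compact_continuous_image)
  then obtain C3 where C3: "\<And>z. z \<in> T \<Longrightarrow> inverse (norm (deriv R z)) \<le> C3"
    unfolding bounded_pos by (auto simp: norm_inverse)
  define Z where "Z = (\<lambda>n. {z. z \<in> ball 0 1 \<and> z ^ (m ^ n) = z0})"
  have finZ: "finite (Z n)" for n
    unfolding Z_def by (rule finite_subset[OF _ finite_nth_roots[of "m ^ n" z0]]) (use m1 in auto)
  \<comment> \<open>A constant function on a disc around the image of a root: the height is the
    fourth power of the distortion bound for |F'|, and the radius is the bound for |R z - R
    \<zeta>|.\<close>
  define t where "t = (\<lambda>n \<zeta> w. ennreal (A ^ 4 * inverse (norm (deriv R \<zeta>)) ^ 4) *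
      indicator (cball (R \<zeta>) (A * norm (deriv R \<zeta>) * D / real (m ^ n))) w)"
  have t_meas: "t n \<zeta> \<in> borel_measurable lborel" for n \<zeta>
    unfolding t_def
    by (intro borel_measurable_times_ennreal borel_measurable_const borel_measurable_indicator) simp
  \<comment> \<open>Taking the maximum with 1 lets the fourth power dominate the p-th power for all
    p in [2,4].\<close>
  define c1 where "c1 = max 1 C ^ 4"
  define c2 where "c2 = max 1 C3 ^ 4 + 1"
  have c: "c1 \<ge> 0" "c2 \<ge> 1" by (auto simp: c1_def c2_def)
  \<comment> \<open>\<open>G1\<close> serves the neighbourhood of infinity and \<open>G3\<close> the
    annuli. \<open>G2\<close> serves the middle region and also absorbs the summand 1 of x^p \<le> 1
    + x^4 on the annuli.\<close>
  define G1 where "G1 = (\<lambda>w. ennreal c1 * dyadic_majorant w)"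
  define G2 where "G2 = (\<lambda>w. ennreal c2 * indicator (cball 0 B) (w::complex))"
  define G3 where "G3 = (\<lambda>w. \<Sum>n. \<Sum>\<zeta>\<in>Z (Suc n). t (Suc n) \<zeta> w)"
  have meas: "G1 \<in> borel_measurable lborel" "G2 \<in> borel_measurable lborel" "G3 \<in> borel_measurable lborel"
    unfolding G1_def G2_def G3_def
    by (intro borel_measurable_suminf_order borel_measurable_sum borel_measurable_times_ennreal
        borel_measurable_const borel_measurable_indicator dyadic_majorant_measurable t_meas; simp)+

  \<comment> \<open>Pointwise majorization, uniform in the exponent\<close>
  have major: "ennreal (norm (deriv F w) powr p) \<le> G1 w + (G2 w + G3 w)"
    if w: "w \<in> basin_inf f" and p: "2 \<le> p" "p \<le> 4" for w p
  proof -
    obtain z where z: "z \<in> ?U" "w = R z" using w R_onto by blast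
    let ?x = "inverse (norm (deriv R z))"
    have x: "norm (deriv F w) = ?x" "?x \<ge> 0" using dF z by auto
    consider "norm z < \<epsilon>" | "z \<in> T" | "norm z \<ge> \<epsilon>" "r0 \<le> norm z ^ m ^ N"
      by (force simp: T_def)
    then show ?thesis
    proof cases
      case 1
      then have s: "norm w \<ge> 1" "?x \<le> C / norm w ^ 2" using pole[of z] z by auto
      have "?x \<le> max 1 C / norm w ^ 2" by (rule order_trans[OF s(2)]) (simp add: divide_right_mono)
      then have "?x powr p \<le> c1 / norm w ^ 4"
        unfolding c1_def using powr_le_power4_div[of ?x "max 1 C" "norm w" p] s(1) p x(2) by simp
      then have "ennreal (?x powr p) \<le> ennreal (c1 * (1 / norm w ^ 4))" by (intro ennreal_leI) simp
      also have "\<dots> = ennreal c1 * ennreal (1 / norm w ^ 4)" using c by (intro ennreal_mult) auto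
      also have "\<dots> \<le> G1 w" unfolding G1_def by (intro mult_left_mono dyadic_majorant_ge s) auto
      finally show ?thesis unfolding x(1) by (rule order_trans) simp
    next
      case 2
      then have "w \<in> cball 0 B" using bdd[of z] z by (simp add: T_def)
      moreover have "?x powr p \<le> c2" 
        using powr_le_max_one_power4[of ?x "max 1 C3" p] C3[OF 2] p x(2) by (simp add: c2_def le_max_iff_disj)
      ultimately have "ennreal (?x powr p) \<le> G2 w" by (simp add: G2_def ennreal_leI)
      also have "\<dots> \<le> G1 w + (G2 w + G3 w)" by (simp add: add_increasing add_increasing2)
      finally show ?thesis unfolding x(1) .
    next
      case 3
      have "norm z < 1" using z by simp
      then obtain k where k: "k \<ge> N" "r0 \<le> norm z ^ m ^ k" "norm z ^ (m * m ^ k) < r0"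
        using exists_annulus_index[of "norm z" r0 m N] r0 m2 3 by auto
      obtain \<zeta> where \<zeta>: "\<zeta> \<in> ball 0 1" "\<zeta> ^ m ^ k = z0"
        "norm (R z - R \<zeta>) \<le> A * norm (deriv R \<zeta>) * D / real (m ^ k)"
        "?x \<le> A * inverse (norm (deriv R \<zeta>))"
        using near[OF MN[OF k(1)] k(2,3)] by blast
      obtain n where n: "k = Suc n" using k(1) by (cases k) (auto simp: N_def)
      have "w \<in> cball 0 B" using bdd[of z] z 3 by simp
      then have g2: "1 \<le> G2 w" using c by (simp add: G2_def)
      have "?x ^ 4 \<le> (A * inverse (norm (deriv R \<zeta>))) ^ 4" using \<zeta>(4) x(2) by (intro power_mono)
      then have "ennreal (?x ^ 4) \<le> ennreal (A ^ 4 * inverse (norm (deriv R \<zeta>)) ^ 4)"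
        by (intro ennreal_leI) (simp add: power_mult_distrib)
      also have "\<dots> = t k \<zeta> w" using \<zeta>(3) z by (simp add: t_def dist_norm norm_minus_commute)
      also have "\<dots> \<le> (\<Sum>\<zeta>\<in>Z k. t k \<zeta> w)" using \<zeta> finZ by (intro member_le_sum) (auto simp: Z_def)
      also have "\<dots> \<le> G3 w" unfolding G3_def n by (rule ennreal_term_le_suminf)
      finally have g3: "ennreal (?x ^ 4) \<le> G3 w" .
      have "ennreal (?x powr p) \<le> ennreal (1 + ?x ^ 4)"
        by (intro ennreal_leI powr_le_one_plus_power4 x p)
      also have "\<dots> = 1 + ennreal (?x ^ 4)" by (simp add: ennreal_plus)
      also have "\<dots> \<le> G2 w + G3 w" by (intro add_mono g2 g3)
      finally show ?thesis unfolding x(1) by (rule order_trans) simp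
    qed
  qed

  \<comment> \<open>Integration of the majorant\<close>
  define b where "b = pi * A ^ 6 * D ^ 2 / (norm (deriv R z0) * r0) ^ 2"
  have b: "b \<ge> 0" by (simp add: b_def)
  define s where "s = (\<lambda>n. real m powr (- 4 * real (Suc n)) * S_sum f R z0 (Suc n))"
  have s0: "s n \<ge> 0" for n by (simp add: s_def S_sum_def sum_nonneg)
  have t_int: "(\<integral>\<^sup>+ w. t n \<zeta> w \<partial>lborel) \<le>
      ennreal (b * (real m powr (- 4 * real n) * (norm (deriv (poly f ^^ n) (R \<zeta>)))\<^sup>2))"
    if "\<zeta> \<in> Z n" for n \<zeta>
  proof -
    let ?q = "norm (deriv R \<zeta>)" and ?P = "norm (deriv (poly f ^^ n) (R \<zeta>))" and ?M = "real m ^ n"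
    have Mp: "?M > 0" using m1 by simp
    have \<zeta>: "\<zeta> \<in> ball 0 1" "\<zeta> ^ m ^ n = z0" using that by (auto simp: Z_def)
    then have "\<zeta> \<in> ?U" using z0U m1 by (auto simp: power_0_left split: if_splits)
    then have q: "?q > 0" using nz by simp
    have iq: "inverse ?q \<le> ?P / (norm (deriv R z0) * r0 * ?M)"
      using inverse_deriv_at_root_bound[OF R_holo R_inj R_onto conj' m1 \<zeta> z0U] z0 by simp
    have "(\<integral>\<^sup>+ w. t n \<zeta> w \<partial>lborel) = ennreal (A ^ 4 * inverse ?q ^ 4) * ennreal (pi * (A * ?q * D / ?M)\<^sup>2)"
      using A D unfolding t_def by (simp add: nn_integral_cmult_indicator emeasure_cball_complex)
    also have "\<dots> = ennreal (A ^ 4 * inverse ?q ^ 4 * (pi * (A * ?q * D / ?M)\<^sup>2))"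
      by (rule ennreal_mult[symmetric]) auto
    \<comment> \<open>The disc area cancels two of the four factors 1/|R'|. The remaining square
      gives |(f^n)'|^2 / M^2 by the bound at roots, and the M^(-2) of the area completes the weight
      M^(-4).\<close>
    also have "A ^ 4 * inverse ?q ^ 4 * (pi * (A * ?q * D / ?M)\<^sup>2) = pi * A ^ 6 * D ^ 2 / ?M ^ 2 * (inverse ?q) ^ 2"
      using q Mp by (simp add: field_simps power2_eq_square eval_nat_numeral)
    also have "ennreal \<dots> \<le> ennreal (pi * A ^ 6 * D ^ 2 / ?M ^ 2 * (?P / (norm (deriv R z0) * r0 * ?M)) ^ 2)"
      using iq q A by (intro ennreal_leI mult_left_mono power_mono) auto
    also have "pi * A ^ 6 * D ^ 2 / ?M ^ 2 * (?P / (norm (deriv R z0) * r0 * ?M)) ^ 2 =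
        b * (1 / ?M ^ 4 * ?P\<^sup>2)"
      unfolding b_def by (simp add: power_divide power_mult_distrib power2_eq_square eval_nat_numeral)
    also have "1 / ?M ^ 4 = real m powr (- 4 * real n)"
    proof -
      have "real m powr (- 4 * real n) = inverse (real m powr (real (n * 4)))"
        by (simp add: powr_minus mult.commute)
      also have "\<dots> = inverse (?M ^ 4)"
        using m1 by (subst powr_realpow) (auto simp: power_mult)
      finally show ?thesis by (simp add: divide_inverse)
    qed
    finally show ?thesis .
  qed
  have int_n: "(\<integral>\<^sup>+ w. (\<Sum>\<zeta>\<in>Z (Suc n). t (Suc n) \<zeta> w) \<partial>lborel) \<le> ennreal (b * s n)" for n
  proof -
    have "(\<integral>\<^sup>+ w. (\<Sum>\<zeta>\<in>Z (Suc n). t (Suc n) \<zeta> w) \<partial>lborel) = (\<Sum>\<zeta>\<in>Z (Suc n). \<integral>\<^sup>+ w. t (Suc n) \<zeta> w \<partial>lborel)"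
      by (rule nn_integral_sum) (rule t_meas)
    also have "\<dots> \<le> (\<Sum>\<zeta>\<in>Z (Suc n). ennreal (b * (real m powr (- 4 * real (Suc n)) *
        (norm (deriv (poly f ^^ Suc n) (R \<zeta>)))\<^sup>2)))"
      by (rule sum_mono) (rule t_int)
    also have "\<dots> = ennreal (\<Sum>\<zeta>\<in>Z (Suc n). b * (real m powr (- 4 * real (Suc n)) *
        (norm (deriv (poly f ^^ Suc n) (R \<zeta>)))\<^sup>2))"
      using b by (intro sum_ennreal) auto
    also have "(\<Sum>\<zeta>\<in>Z (Suc n). b * (real m powr (- 4 * real (Suc n)) *
        (norm (deriv (poly f ^^ Suc n) (R \<zeta>)))\<^sup>2)) = b * s n"
      unfolding s_def S_sum_def Z_def deg by (simp add: sum_distrib_left)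
    finally show ?thesis .
  qed
  \<comment> \<open>The total integral of \<open>G1\<close> and \<open>G2\<close>. Adding 1 to it
    below yields the strict inequality, as the upper bound obtained is finite.\<close>
  define c0 where "c0 = c1 * (16 * pi / 3) + c2 * (pi * B\<^sup>2)"
  have bound: "(\<integral>\<^sup>+ z \<in> basin_inf f. ennreal (cmod (deriv F z) powr p) \<partial>lborel)
      < ennreal (b * (\<Sum>n. s n) + (c0 + 1))" if p: "2 \<le> p" "p \<le> 4" and sum: "summable s" for p
  proof -
    have "(\<integral>\<^sup>+ z \<in> basin_inf f. ennreal (cmod (deriv F z) powr p) \<partial>lborel)
        \<le> (\<integral>\<^sup>+ w. G1 w + (G2 w + G3 w) \<partial>lborel)"
      by (intro nn_integral_mono) (use major p in \<open>auto simp: indicator_def\<close>)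
    also have "\<dots> = (\<integral>\<^sup>+ w. G1 w \<partial>lborel) + ((\<integral>\<^sup>+ w. G2 w \<partial>lborel) + (\<integral>\<^sup>+ w. G3 w \<partial>lborel))"
      using meas by (simp add: nn_integral_add)
    also have "(\<integral>\<^sup>+ w. G1 w \<partial>lborel) = ennreal (c1 * (16 * pi / 3))"
      unfolding G1_def nn_integral_cmult[OF dyadic_majorant_measurable] dyadic_majorant_integral
      by (rule ennreal_mult[symmetric]) (use c in auto)
    also have "(\<integral>\<^sup>+ w. G2 w \<partial>lborel) = ennreal (c2 * (pi * B\<^sup>2))"
      unfolding G2_def using c B by (simp add: nn_integral_cmult_indicator emeasure_cball_complex ennreal_mult)
    also have "(\<integral>\<^sup>+ w. G3 w \<partial>lborel) \<le> ennreal (b * (\<Sum>n. s n))"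
    proof -
      have "(\<integral>\<^sup>+ w. G3 w \<partial>lborel) = (\<Sum>n. \<integral>\<^sup>+ w. (\<Sum>\<zeta>\<in>Z (Suc n). t (Suc n) \<zeta> w) \<partial>lborel)"
        unfolding G3_def by (intro nn_integral_suminf borel_measurable_sum t_meas)
      also have "\<dots> \<le> (\<Sum>n. ennreal (b * s n))" by (intro suminf_le int_n summableI)
      also have "\<dots> = ennreal (\<Sum>n. b * s n)"
        using b s0 sum by (intro suminf_ennreal2) (auto intro: summable_mult)
      also have "(\<Sum>n. b * s n) = b * (\<Sum>n. s n)" using sum by (rule suminf_mult)
      finally show ?thesis .
    qed
    also have "ennreal (c1 * (16 * pi / 3)) + (ennreal (c2 * (pi * B\<^sup>2)) + ennreal (b * (\<Sum>n. s n)))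
        = ennreal (b * (\<Sum>n. s n) + c0)"
      using c b suminf_nonneg[OF sum s0] by (simp add: c0_def ennreal_plus[symmetric] ac_simps del: ennreal_plus)
    also have "\<dots> < ennreal (b * (\<Sum>n. s n) + (c0 + 1))"
      using c b suminf_nonneg[OF sum s0] by (intro ennreal_lessI) (auto simp: c0_def intro!: add_nonneg_pos add_nonneg_nonneg)
    finally show ?thesis by (simp add: add_mono)
  qed
  show ?thesis
    using bound unfolding s_def by blast
qed

end
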